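(* For every integer $k > 1$, $\mathrm{ATIME}^{op}[\log^k n, 1] \subsetneq \mathrm{ATIME}^{op}[\log^{k+1} n, 1]$.
   Context: Throughout, $\log n$ denotes $\log_2 n$ and $\log^k n$ denotes $(\log n)^k$. A random-access Turing machine is a multi-tape Turing machine with a read-only random-access input of length $n+1$ (the input binary string followed by an endmark $\triangleleft$), a fixed number of read-write working tapes, and a read-write input address-tape of length $\lceil\log n\rceil$; at each step the binary number on the address-tape determines which input cell is read (the endmark cell if the number exceeds $n$). A random-access alternating Turing machine is such a machine whose states are partitioned into existential and universal states, with the usual alternating acceptance condition (a configuration is accepting iff it is in an accepting final state, or it is existential and some successor configuration is accepting, or it is universal, has a successor, and all successor configurations are accepting). $\mathrm{ATIME}^{op}[f(n), m]$ is the class of languages of binary strings accepted by a random-access alternating Turing machine that starts in a universal state, makes at most $O(f(n))$ steps on inputs of length $n$, and whose computations have at most $m$ alternating blocks of universal/existential states (i.e. at most $m-1$ alternations). In particular $\mathrm{ATIME}^{op}[f(n),1]$ corresponds to machines using only universal states. *)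

theory Defs
  imports Complex_Main "HOL-Library.Landau_Symbols"
begin

datatype input_symbol = Bit bool | Endmark

datatype move = MoveLeft | MoveStay | MoveRight

text \<open>States and working-tape symbols are natural numbers; the symbol 0 is the blank.
  In the lists \<open>work_read\<close> and \<open>work_action\<close> the \<open>i\<close>-th entry belongs to the
  \<open>i\<close>-th working tape.\<close>

record transition =
  source :: nat
  input_read :: input_symbol
  addr_read :: bool
  work_read :: "nat list"
  target :: nat
  addr_write :: bool
  addr_move :: move
  work_action :: "(nat \<times> move) list"

record ratm =
  existential :: "nat set"
  universal :: "nat set"
  start :: nat
  accepting :: "nat set"
  alphabet :: "nat set"
  num_tapes :: nat
  transitions :: "transition set"

definition states :: "ratm \<Rightarrow> nat set" where
  "states M = existential M \<union> universal M"

text \<open>Accepting states are final: no transition leaves them. A configuration in any other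
  state that has no successor is halting and rejecting.\<close>

definition wf_transition :: "ratm \<Rightarrow> transition \<Rightarrow> bool" where
  "wf_transition M \<tau> \<longleftrightarrow>
     source \<tau> \<in> states M - accepting M \<and> target \<tau> \<in> states M \<and>
     length (work_read \<tau>) = num_tapes M \<and> set (work_read \<tau>) \<subseteq> alphabet M \<and>
     length (work_action \<tau>) = num_tapes M \<and> fst ` set (work_action \<tau>) \<subseteq> alphabet M"

definition wf_ratm :: "ratm \<Rightarrow> bool" where
  "wf_ratm M \<longleftrightarrow>
     finite (existential M) \<and> finite (universal M) \<and> existential M \<inter> universal M = {} \<and>
     start M \<in> states M \<and> accepting M \<subseteq> states M \<and>
     finite (alphabet M) \<and> 0 \<in> alphabet M \<and>
     (\<forall>\<tau> \<in> transitions M. wf_transition M \<tau>)"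

text \<open>The address tape is a list of bits. A working tape is infinite in both directions and is
  stored together with its head position.\<close>

record config =
  state :: nat
  addr_tape :: "bool list"
  addr_head :: nat
  work :: "(int \<times> (int \<Rightarrow> nat)) list"

text \<open>For \<open>n = 0\<close> the library convention \<open>ln 0 = 0\<close> yields an address tape of length 0.\<close>

definition addr_length :: "nat \<Rightarrow> nat" where
  "addr_length n = nat \<lceil>log 2 (real n)\<rceil>"

definition init_config :: "ratm \<Rightarrow> bool list \<Rightarrow> config" where
  "init_config M w =
     \<lparr>state = start M, addr_tape = replicate (addr_length (length w)) False, addr_head = 0,
      work = replicate (num_tapes M) (0, \<lambda>_. 0)\<rparr>"

text \<open>The leftmost bit of the address tape is the most significant one. Input cells are
  numbered from 0, so that \<open>\<lceil>log n\<rceil>\<close> address bits reach all \<open>n\<close> input bits and the endmark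
  is cell number \<open>n\<close>.\<close>

definition addr_value :: "bool list \<Rightarrow> nat" where
  "addr_value a = horner_sum of_bool 2 (rev a)"

definition scanned_input :: "bool list \<Rightarrow> bool list \<Rightarrow> input_symbol" where
  "scanned_input w a =
     (if addr_value a < length w then Bit (w ! addr_value a) else Endmark)"

text \<open>On an address tape of length 0 the head scans the bit 0, and writing has no effect.\<close>

definition scanned_addr :: "bool list \<Rightarrow> nat \<Rightarrow> bool" where
  "scanned_addr a h \<longleftrightarrow> h < length a \<and> a ! h"

text \<open>The head of the address tape stays in place when told to move off either end.\<close>

fun move_addr :: "nat \<Rightarrow> move \<Rightarrow> nat \<Rightarrow> nat" where
  "move_addr l MoveLeft h = h - 1"
| "move_addr l MoveStay h = h"
| "move_addr l MoveRight h = (if Suc h < l then Suc h else h)"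

fun move_work :: "move \<Rightarrow> int \<Rightarrow> int" where
  "move_work MoveLeft p = p - 1"
| "move_work MoveStay p = p"
| "move_work MoveRight p = p + 1"

fun act_work :: "nat \<times> move \<Rightarrow> int \<times> (int \<Rightarrow> nat) \<Rightarrow> int \<times> (int \<Rightarrow> nat)" where
  "act_work (s, m) (p, tp) = (move_work m p, tp(p := s))"

definition enabled :: "bool list \<Rightarrow> transition \<Rightarrow> config \<Rightarrow> bool" where
  "enabled w \<tau> c \<longleftrightarrow>
     source \<tau> = state c \<and>
     input_read \<tau> = scanned_input w (addr_tape c) \<and>
     addr_read \<tau> = scanned_addr (addr_tape c) (addr_head c) \<and>
     work_read \<tau> = map (\<lambda>(p, tp). tp p) (work c)"

definition fire :: "transition \<Rightarrow> config \<Rightarrow> config" where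
  "fire \<tau> c =
     \<lparr>state = target \<tau>,
      addr_tape = (addr_tape c)[addr_head c := addr_write \<tau>],
      addr_head = move_addr (length (addr_tape c)) (addr_move \<tau>) (addr_head c),
      work = map2 act_work (work_action \<tau>) (work c)\<rparr>"

definition step :: "ratm \<Rightarrow> bool list \<Rightarrow> config \<Rightarrow> config \<Rightarrow> bool" where
  "step M w c d \<longleftrightarrow> (\<exists>\<tau> \<in> transitions M. enabled w \<tau> c \<and> d = fire \<tau> c)"

inductive accepting_config :: "ratm \<Rightarrow> bool list \<Rightarrow> config \<Rightarrow> bool" for M w where
  final: "state c \<in> accepting M \<Longrightarrow> accepting_config M w c"
| existential: "\<lbrakk>state c \<in> existential M; step M w c d; accepting_config M w d\<rbrakk>
    \<Longrightarrow> accepting_config M w c"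
| universal: "\<lbrakk>state c \<in> universal M; \<exists>d. step M w c d;
    \<forall>d. step M w c d \<longrightarrow> accepting_config M w d\<rbrakk> \<Longrightarrow> accepting_config M w c"

definition language :: "ratm \<Rightarrow> bool list set" where
  "language M = {w. accepting_config M w (init_config M w)}"

text \<open>Computations are finite initial segments of runs; they need not end in a halting
  configuration.\<close>

definition computation :: "ratm \<Rightarrow> bool list \<Rightarrow> config list \<Rightarrow> bool" where
  "computation M w cs \<longleftrightarrow>
     cs \<noteq> [] \<and> hd cs = init_config M w \<and> successively (step M w) cs"

definition num_steps :: "config list \<Rightarrow> nat" where
  "num_steps cs = length cs - 1"

text \<open>The number of maximal blocks of consecutive configurations of the same type.\<close>

definition num_blocks :: "ratm \<Rightarrow> config list \<Rightarrow> nat" where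
  "num_blocks M cs = length (remdups_adj (map (\<lambda>c. state c \<in> universal M) cs))"

text \<open>The time bound \<open>t\<close> applies to every input, so all computations halt, while its growth is
  compared with \<open>f\<close> only asymptotically (note that \<open>log n\<close> vanishes at \<open>n = 1\<close>).\<close>

definition ATIME_op :: "(nat \<Rightarrow> real) \<Rightarrow> nat \<Rightarrow> bool list set set" where
  "ATIME_op f m =
     {language M | M. wf_ratm M \<and> start M \<in> universal M \<and>
        (\<exists>t :: nat \<Rightarrow> nat. (\<lambda>n. real (t n)) \<in> O(f) \<and>
           (\<forall>w cs. computation M w cs \<longrightarrow>
              num_steps cs \<le> t (length w) \<and> num_blocks M cs \<le> m))}"

end

theory Submission
  imports Defs "HOL-Library.Countable"
begin

text \<open>A universal machine rejects along a single run, which inspects at most \<open>t(n) + 1\<close> input cells;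
  changing any other cell leaves the word rejected. The separating machine looks for a zero among the
  cells whose addresses have leading bit 1 and exactly \<open>k + 1\<close> further ones. It rejects the
  all-ones word, but accepts it after a change in any of these \<open>(l - 1) choose (k + 1)\<close> cells, where
  \<open>n = 2\<^sup>l\<close>; that number outgrows every \<open>O(l\<^sup>k)\<close>. The addresses are enumerated on the address tape
  alone, in \<open>O(l\<^sup>k\<^sup>+\<^sup>1)\<close> steps: \<open>k + 1\<close> nested loops each move one of the ones to the right.\<close>

section \<open>Rejection certificates of universal machines\<close>

lemma step_cong_input:
  assumes "scanned_input w (addr_tape c) = scanned_input w' (addr_tape c)"
  shows "step M w c d \<longleftrightarrow> step M w' c d"
  using assms by (simp add: step_def enabled_def)

lemma step_state_states:
  assumes "wf_ratm M" "step M w c d"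
  shows "state d \<in> states M"
proof -
  obtain \<tau> where "\<tau> \<in> transitions M" "d = fire \<tau> c"
    using assms(2) unfolding step_def by blast
  then show ?thesis
    using assms(1) by (simp add: wf_ratm_def wf_transition_def fire_def)
qed

lemma scanned_input_cong:
  assumes "length w' = length w" "addr_value a < length w \<Longrightarrow> w' ! addr_value a = w ! addr_value a"
  shows "scanned_input w a = scanned_input w' a"
  using assms by (auto simp: scanned_input_def)

lemma not_accepting_universal:
  assumes "wf_ratm M" "state c \<in> universal M" "state c \<notin> accepting M"
    and "(\<forall>d. \<not> step M w c d) \<or> (\<exists>d. step M w c d \<and> \<not> accepting_config M w d)"
  shows "\<not> accepting_config M w c"
proof
  assume "accepting_config M w c"
  then show False
    using assms by cases (auto simp: wf_ratm_def)
qed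

text \<open>A rejected universal configuration either has no successor or has a rejected one, so
  some halting run consists of rejected configurations only. \<open>P\<close> collects the cells
  scanned along it, at most one per configuration; a word agreeing with \<open>w\<close> on these
  cells has the same run. Reading the endmark depends on the length alone, which is why cells beyond
  the input impose no condition.\<close>

lemma rejection_certificate:
  assumes wf: "wf_ratm M"
    and "\<not> accepting_config M w c"
    and "\<And>cs. \<lbrakk>cs \<noteq> []; hd cs = c; successively (step M w) cs\<rbrakk>
      \<Longrightarrow> length cs \<le> N \<and> (\<forall>x \<in> set cs. state x \<in> universal M)"
  shows "\<exists>P. finite P \<and> card P \<le> N \<and>
    (\<forall>w'. length w' = length w \<and> (\<forall>i \<in> P. i < length w \<longrightarrow> w' ! i = w ! i) \<longrightarrow>
      \<not> accepting_config M w' c)"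
  using assms(2,3)
proof (induction N arbitrary: c)
  case 0
  \<comment> \<open>The one-element list \<open>[c]\<close> is already a run, so
    \<open>N = 0\<close> is impossible.\<close>
  from "0.prems"(2)[of "[c]"] show ?case by simp
next
  case (Suc N)
  have univ: "state c \<in> universal M"
    using Suc.prems(2)[of "[c]"] by simp
  have nacc: "state c \<notin> accepting M"
    using Suc.prems(1) accepting_config.final by blast
  let ?i = "addr_value (addr_tape c)"
  show ?case
  proof (cases "\<exists>d. step M w c d")
    case False
    have "\<not> accepting_config M w' c"
      if "length w' = length w" "\<forall>i \<in> {?i}. i < length w \<longrightarrow> w' ! i = w ! i" for w'
    proof (rule not_accepting_universal[OF wf univ nacc])
      have "scanned_input w (addr_tape c) = scanned_input w' (addr_tape c)"
        using that by (intro scanned_input_cong) auto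
      then show "(\<forall>d. \<not> step M w' c d) \<or> (\<exists>d. step M w' c d \<and> \<not> accepting_config M w' d)"
        using False step_cong_input by blast
    qed
    then show ?thesis
      by (intro exI[of _ "{?i}"]) auto
  next
    case True
    then obtain d where d: "step M w c d" "\<not> accepting_config M w d"
      using Suc.prems(1) univ accepting_config.universal by blast
    have "length cs \<le> N \<and> (\<forall>x \<in> set cs. state x \<in> universal M)"
      if "cs \<noteq> []" "hd cs = d" "successively (step M w) cs" for cs
      using Suc.prems(2)[of "c # cs"] that d(1) by (cases cs) auto
    from Suc.IH[OF d(2) this] obtain P where P: "finite P" "card P \<le> N"
      "\<And>w'. length w' = length w \<Longrightarrow> (\<forall>i \<in> P. i < length w \<longrightarrow> w' ! i = w ! i) \<Longrightarrow>
         \<not> accepting_config M w' d"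
      by blast
    have "\<not> accepting_config M w' c"
      if w': "length w' = length w" "\<forall>i \<in> insert ?i P. i < length w \<longrightarrow> w' ! i = w ! i" for w'
    proof (rule not_accepting_universal[OF wf univ nacc])
      have "scanned_input w (addr_tape c) = scanned_input w' (addr_tape c)"
        using w' by (intro scanned_input_cong) auto
      then show "(\<forall>d. \<not> step M w' c d) \<or> (\<exists>d. step M w' c d \<and> \<not> accepting_config M w' d)"
        using d(1) P(3)[of w'] w' step_cong_input by blast
    qed
    moreover have "card (insert ?i P) \<le> Suc N"
      using P(1,2) by (simp add: card_insert_if)
    ultimately show ?thesis
      using P(1) by (intro exI[of _ "insert ?i P"]) auto
  qed
qed

lemma num_blocks_le_1_universal:
  assumes "num_blocks M cs \<le> 1" "cs \<noteq> []" "state (hd cs) \<in> universal M" "c \<in> set cs"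
  shows "state c \<in> universal M"
proof -
  let ?xs = "map (\<lambda>c. state c \<in> universal M) cs"
  have "length (remdups_adj ?xs) \<le> 1"
    using assms(1) by (simp add: num_blocks_def)
  then have "\<exists>b. set (remdups_adj ?xs) \<subseteq> {b}"
    by (cases "remdups_adj ?xs") auto
  then obtain b where "set ?xs \<subseteq> {b}"
    by auto
  then have "(state x \<in> universal M) = b" if "x \<in> set cs" for x
    using that by auto
  from this[OF assms(4)] this[OF hd_in_set[OF assms(2)]] show ?thesis
    using assms(3) by blast
qed

text \<open>This form mentions the language only and is all that the lower bound uses. The
  \<open>Suc\<close> appears because \<open>t\<close> steps pass through \<open>t + 1\<close>
  configurations, each scanning one cell.\<close>

lemma ATIME_op_rejection_certificate:
  assumes "L \<in> ATIME_op f 1"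
  obtains t :: "nat \<Rightarrow> nat" where "(\<lambda>n. real (t n)) \<in> O(f)"
    "\<And>w. w \<notin> L \<Longrightarrow> \<exists>P. finite P \<and> card P \<le> Suc (t (length w)) \<and>
      (\<forall>w'. length w' = length w \<and> (\<forall>i \<in> P. i < length w \<longrightarrow> w' ! i = w ! i) \<longrightarrow> w' \<notin> L)"
proof -
  from assms obtain M t where M: "L = language M" "wf_ratm M" "start M \<in> universal M"
    and t: "(\<lambda>n. real (t n)) \<in> O(f)"
    and comp: "\<And>w cs. computation M w cs \<Longrightarrow> num_steps cs \<le> t (length w) \<and> num_blocks M cs \<le> 1"
    unfolding ATIME_op_def by blast
  show thesis
  proof (rule that[OF t])
    fix w assume "w \<notin> L"
    then have rejected: "\<not> accepting_config M w (init_config M w)"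
      using M(1) by (simp add: language_def)
    have bound: "length cs \<le> Suc (t (length w)) \<and> (\<forall>x \<in> set cs. state x \<in> universal M)"
      if cs: "cs \<noteq> []" "hd cs = init_config M w" "successively (step M w) cs" for cs
    proof -
      from comp[of w cs] cs have "num_steps cs \<le> t (length w)" and blocks: "num_blocks M cs \<le> 1"
        by (auto simp: computation_def)
      moreover have "state (hd cs) \<in> universal M"
        using cs(2) M(3) by (simp add: init_config_def)
      note num_blocks_le_1_universal[OF blocks cs(1) this]
      ultimately show ?thesis
        by (auto simp: num_steps_def)
    qed
    from rejection_certificate[OF M(2) rejected bound]
    obtain P where P: "finite P" "card P \<le> Suc (t (length w))"
      "\<And>w'. length w' = length w \<Longrightarrow> (\<forall>i \<in> P. i < length w \<longrightarrow> w' ! i = w ! i) \<Longrightarrow>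
         \<not> accepting_config M w' (init_config M w)"
      by blast
    \<comment> \<open>The certificate starts from \<open>init_config M w\<close>, which depends on
      the word only through its length and hence is also the initial configuration on
      \<open>w'\<close>.\<close>
    have "w' \<notin> L" if "length w' = length w" "\<forall>i \<in> P. i < length w \<longrightarrow> w' ! i = w ! i" for w'
      using P(3)[OF that] that(1) M(1) by (simp add: language_def init_config_def)
    then show "\<exists>P. finite P \<and> card P \<le> Suc (t (length w)) \<and>
      (\<forall>w'. length w' = length w \<and> (\<forall>i \<in> P. i < length w \<longrightarrow> w' ! i = w ! i) \<longrightarrow> w' \<notin> L)"
      using P(1,2) by blast
  qed
qed

section \<open>The enumerating machine\<close>

text \<open>\<open>Down j\<close> places \<open>j\<close> more ones from the head position on, all cells to the right being 0. If it reads a 1,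
  then the last move to the right was blocked, so the one placed last is in the rightmost cell.
  \<open>Up j\<close> walks left to the next one, with all placements of \<open>j\<close> ones to the right of it done. The machine
  starts in \<open>Down (Suc K)\<close>, and the one it writes in the leftmost cell is never moved.\<close>

datatype scan_state = Accept | Down nat | Up nat

instance scan_state :: countable
  by countable_datatype

text \<open>The guards \<open>j < K\<close> make \<open>Up K\<close> halt on the leading one, which
  ends the enumeration, and make \<open>Down K\<close> halt when a one-cell tape blocks its move.
  The equation for \<open>Up 0\<close> on 0 serves the empty address tape, which always reads
  0.\<close>

fun prog :: "nat \<Rightarrow> scan_state \<Rightarrow> bool \<Rightarrow> (scan_state \<times> bool \<times> move) option" where
  "prog K (Down 0) False = Some (Up 0, False, MoveLeft)"
| "prog K (Down (Suc j)) False = Some (Down j, True, MoveRight)"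
| "prog K (Down j) True = (if j < K then Some (Up (Suc j), False, MoveLeft) else None)"
| "prog K (Up j) True = (if j < K then Some (Down (Suc j), False, MoveRight) else None)"
| "prog K (Up 0) False = None"
| "prog K (Up (Suc j)) False = Some (Up (Suc j), False, MoveLeft)"
| "prog K Accept b = None"

definition scan_states :: "nat \<Rightarrow> scan_state set" where
  "scan_states K = insert Accept (Down ` {..Suc K} \<union> Up ` {..K})"

definition scan_transition :: "scan_state \<Rightarrow> input_symbol \<Rightarrow> bool \<Rightarrow> scan_state \<times> bool \<times> move \<Rightarrow> transition"
  where "scan_transition s i b r =
    \<lparr>source = to_nat s, input_read = i, addr_read = b, work_read = [],
     target = to_nat (fst r), addr_write = fst (snd r), addr_move = snd (snd r), work_action = []\<rparr>"

text \<open>A zero in the input sends every state to \<open>Accept\<close> at once; any other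
  symbol, the endmark included, lets \<open>prog\<close> continue. Thus the input never influences
  the order of enumeration, and a halt of \<open>prog\<close> rejects.\<close>

definition scan_machine :: "nat \<Rightarrow> ratm" where
  "scan_machine K =
    \<lparr>existential = {}, universal = to_nat ` scan_states K, start = to_nat (Down (Suc K)),
     accepting = {to_nat Accept}, alphabet = {0}, num_tapes = 0,
     transitions =
       {scan_transition s i b r | s i b r. s \<in> scan_states K \<and> i \<noteq> Bit False \<and> prog K s b = Some r} \<union>
       {scan_transition s (Bit False) b (Accept, b, MoveStay) | s b. s \<in> scan_states K - {Accept}}\<rparr>"

type_synonym scan_config = "scan_state \<times> bool list \<times> nat"

fun config_of :: "scan_config \<Rightarrow> config" where
  "config_of (s, a, h) = \<lparr>state = to_nat s, addr_tape = a, addr_head = h, work = []\<rparr>"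

fun next_config :: "nat \<Rightarrow> scan_config \<Rightarrow> scan_config option" where
  "next_config K (s, a, h) =
     map_option (\<lambda>(s', b, m). (s', a[h := b], move_addr (length a) m h))
       (prog K s (scanned_addr a h))"

section \<open>Steps and computations of the scanning machine\<close>

lemma prog_scan_states:
  assumes "prog K s b = Some (s', r)" "s \<in> scan_states K"
  shows "s \<noteq> Accept" "s' \<in> scan_states K" "s' \<noteq> Accept"
  using assms by (induction K s b rule: prog.induct) (auto simp: scan_states_def split: if_splits)

lemma wf_scan_machine: "wf_ratm (scan_machine K)"
proof -
  let ?M = "scan_machine K"
  have "wf_transition ?M (scan_transition s i b r)" if "s \<in> scan_states K" "prog K s b = Some r" for s i b r
    using prog_scan_states[of K s b "fst r" "snd r"] that
    by (simp add: wf_transition_def scan_machine_def states_def scan_transition_def)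
  moreover have "wf_transition ?M (scan_transition s i b (Accept, b, MoveStay))"
    if "s \<in> scan_states K - {Accept}" for s i b
    using that by (auto simp: wf_transition_def scan_machine_def states_def scan_transition_def scan_states_def)
  ultimately have "\<forall>\<tau> \<in> transitions ?M. wf_transition ?M \<tau>"
    by (auto simp: scan_machine_def)
  moreover have "finite (scan_states K)" "Accept \<in> scan_states K" "Down (Suc K) \<in> scan_states K"
    by (auto simp: scan_states_def)
  ultimately show ?thesis
    by (simp add: wf_ratm_def scan_machine_def states_def)
qed

lemma step_scan_machine_False_ex:
  assumes "scanned_input w a = Bit False" "s \<in> scan_states K" "s \<noteq> Accept"
  shows "\<exists>d. step (scan_machine K) w (config_of (s, a, h)) d"
proof -
  let ?t = "scan_transition s (Bit False) (scanned_addr a h) (Accept, scanned_addr a h, MoveStay)"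
  have "?t \<in> transitions (scan_machine K)"
    using assms by (auto simp: scan_machine_def)
  moreover have "enabled w ?t (config_of (s, a, h))"
    using assms by (simp add: enabled_def scan_transition_def)
  ultimately show ?thesis
    unfolding step_def by blast
qed

lemma step_scan_machine_False:
  assumes "scanned_input w a = Bit False" "step (scan_machine K) w (config_of (s, a, h)) d"
  shows "state d = to_nat Accept"
  using assms
  by (auto simp: step_def scan_machine_def enabled_def scan_transition_def fire_def)

text \<open>As long as no zero is scanned, the machine is deterministic and its successor does not
  depend on the word.\<close>

lemma step_scan_machine:
  assumes "scanned_input w (fst (snd c)) \<noteq> Bit False" "fst c \<in> scan_states K"
  shows "step (scan_machine K) w (config_of c) d \<longleftrightarrow>
    (\<exists>c'. next_config K c = Some c' \<and> d = config_of c')"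
proof -
  obtain s a h where c: "c = (s, a, h)"
    using prod_cases3 by blast
  show ?thesis
  proof
    assume "step (scan_machine K) w (config_of c) d"
    then show "\<exists>c'. next_config K c = Some c' \<and> d = config_of c'"
      using assms by (auto simp: c step_def scan_machine_def enabled_def scan_transition_def fire_def)
  next
    assume "\<exists>c'. next_config K c = Some c' \<and> d = config_of c'"
    then obtain r where r: "prog K s (scanned_addr a h) = Some r"
      "d = config_of (fst r, a[h := fst (snd r)], move_addr (length a) (snd (snd r)) h)"
      by (auto simp: c)
    let ?t = "scan_transition s (scanned_input w a) (scanned_addr a h) r"
    have "?t \<in> transitions (scan_machine K)"
      unfolding scan_machine_def using r(1) assms by (simp add: c) (metis prod.collapse)
    moreover have "enabled w ?t (config_of c)" "d = fire ?t (config_of c)"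
      using r(2) by (auto simp: c enabled_def scan_transition_def fire_def)
    ultimately show "step (scan_machine K) w (config_of c) d"
      unfolding step_def by blast
  qed
qed

lemma accept_no_step:
  assumes "state c = to_nat Accept"
  shows "\<not> step (scan_machine K) w c d"
  using assms prog_scan_states
  by (fastforce simp: step_def scan_machine_def enabled_def scan_transition_def)

text \<open>This is the word-independent enumeration, with its number of steps and the set of
  address tapes it passes. The tape of the last configuration is counted only if an earlier
  configuration has it too.\<close>

inductive run :: "nat \<Rightarrow> scan_config \<Rightarrow> nat \<Rightarrow> bool list set \<Rightarrow> scan_config \<Rightarrow> bool" for K where
  run_refl: "run K c 0 {} c"
| run_step: "next_config K c = Some c' \<Longrightarrow> run K c' n V d \<Longrightarrow> run K c (Suc n) (insert (fst (snd c)) V) d"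

lemma run_trans: "run K c n V d \<Longrightarrow> run K d m W e \<Longrightarrow> run K c (n + m) (V \<union> W) e"
  by (induction rule: run.induct) (auto intro: run_step)

lemma next_config_scan_states:
  assumes "next_config K c = Some c'" "fst c \<in> scan_states K"
  shows "fst c' \<in> scan_states K" "fst c \<noteq> Accept" "fst c' \<noteq> Accept"
  using assms prog_scan_states by (cases c; fastforce)+

text \<open>A computation follows the run until it scans a zero and then makes one last step into
  \<open>Accept\<close>. The run has \<open>n + 1\<close> configurations, and the zero may be
  scanned at the last of them, hence \<open>n + 2\<close>.\<close>

lemma run_computation_length:
  assumes "run K c n V d" "next_config K d = None" "fst c \<in> scan_states K" "fst c \<noteq> Accept"
    "successively (step (scan_machine K) w) cs" "cs \<noteq> []" "hd cs = config_of c"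
  shows "length cs \<le> n + 2"
  using assms
proof (induction arbitrary: cs rule: run.induct)
  case (run_refl c)
  show ?case
  proof (cases "scanned_input w (fst (snd c)) = Bit False")
    case True
    obtain s a h where c: "c = (s, a, h)" using prod_cases3 by blast
    show ?thesis
    proof (cases cs)
      case (Cons x xs)
      show ?thesis
      proof (cases xs)
        case (Cons y ys)
        have "step (scan_machine K) w (config_of c) y"
          using run_refl.prems \<open>cs = x # xs\<close> Cons by simp
        then have "state y = to_nat Accept"
          using step_scan_machine_False True unfolding c by simp
        then have "ys = []"
          using accept_no_step run_refl.prems(4) \<open>cs = x # xs\<close> Cons by (cases ys) auto
        then show ?thesis using \<open>cs = x # xs\<close> Cons by simp
      qed (use Cons in simp)
    qed simp
  next
    case False
    then have "\<not> step (scan_machine K) w (config_of c) y" for y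
      using step_scan_machine run_refl.prems by simp
    then have "tl cs = []"
      using run_refl.prems by (cases cs; cases "tl cs") auto
    then show ?thesis by (cases cs) auto
  qed
next
  case (run_step c c' n V d)
  note c' = next_config_scan_states[OF run_step.hyps(1) run_step.prems(2)]
  obtain s a h where c: "c = (s, a, h)" using prod_cases3 by blast
  obtain xs where xs: "cs = config_of c # xs"
    using run_step.prems by (cases cs) auto
  show ?case
  proof (cases xs)
    case (Cons y ys)
    then have st: "step (scan_machine K) w (config_of c) y" and suc: "successively (step (scan_machine K) w) xs"
      using run_step.prems xs by auto
    show ?thesis
    proof (cases "scanned_input w (fst (snd c)) = Bit False")
      case True
      then have "state y = to_nat Accept"
        using step_scan_machine_False True st unfolding c by simp
      then have "ys = []"
        using accept_no_step suc Cons by (cases ys) auto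
      then show ?thesis using xs Cons by simp
    next
      case False
      then have "y = config_of c'"
        using st step_scan_machine run_step.prems(2) run_step.hyps(1) by simp
      then show ?thesis
        using run_step.IH[of xs] run_step.prems(1) c' suc Cons xs by simp
    qed
  qed (use xs in simp)
qed

text \<open>Before the first zero on the run each configuration has exactly one successor; at that
  zero all successors are accepting, and acceptance propagates back to \<open>c\<close>.\<close>

lemma run_accepts:
  assumes "run K c n V d" "fst c \<in> scan_states K" "a \<in> V" "scanned_input w a = Bit False"
  shows "accepting_config (scan_machine K) w (config_of c)"
  using assms
proof (induction rule: run.induct)
  case (run_step c c' n V d)
  note c' = next_config_scan_states[OF run_step.hyps(1) run_step.prems(1)]
  obtain s b h where c: "c = (s, b, h)" using prod_cases3 by blast
  have univ: "state (config_of c) \<in> universal (scan_machine K)"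
    using run_step.prems(1) by (simp add: c scan_machine_def)
  show ?case
  proof (cases "scanned_input w (fst (snd c)) = Bit False")
    case True
    show ?thesis
    proof (rule accepting_config.universal[OF univ])
      show "\<exists>d. step (scan_machine K) w (config_of c) d"
        unfolding c using True run_step.prems(1) c'(2)
        by (intro step_scan_machine_False_ex) (simp_all add: c)
      show "\<forall>d. step (scan_machine K) w (config_of c) d \<longrightarrow> accepting_config (scan_machine K) w d"
      proof (intro allI impI accepting_config.final)
        fix d assume "step (scan_machine K) w (config_of c) d"
        then have "state d = to_nat Accept"
          using step_scan_machine_False True unfolding c by simp
        then show "state d \<in> accepting (scan_machine K)"
          by (simp add: scan_machine_def)
      qed
    qed
  next
    case False
    then have "a \<in> V"
      using run_step.prems by auto
    then have "accepting_config (scan_machine K) w (config_of c')"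
      using run_step.IH c'(1) run_step.prems(3) by blast
    then show ?thesis
      using step_scan_machine[OF False run_step.prems(1)] run_step.hyps(1)
      by (intro accepting_config.universal[OF univ]) auto
  qed
qed simp

lemma run_rejects:
  assumes "run K c n V d" "next_config K d = None" "fst c \<in> scan_states K" "fst c \<noteq> Accept"
    and nf: "\<And>a. scanned_input w a \<noteq> Bit False"
  shows "\<not> accepting_config (scan_machine K) w (config_of c)"
  using assms(1-4)
proof (induction rule: run.induct)
  case (run_refl c)
  then show ?case
    using step_scan_machine[OF nf]
    by (intro not_accepting_universal[OF wf_scan_machine]) (cases c; auto simp: scan_machine_def)+
next
  case (run_step c c' n V d)
  note c' = next_config_scan_states[OF run_step.hyps(1) run_step.prems(2)]
  have "step (scan_machine K) w (config_of c) (config_of c')"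
    using step_scan_machine[OF nf] run_step.prems(2) run_step.hyps(1) by blast
  then show ?case
    using run_step.IH run_step.prems c'
    by (intro not_accepting_universal[OF wf_scan_machine]) (cases c; auto simp: scan_machine_def)+
qed

section \<open>Enumerating the addresses with a fixed number of ones\<close>

definition weight :: "bool list \<Rightarrow> nat" where
  "weight y = length (filter id y)"

lemma run_single: "next_config K c = Some c' \<Longrightarrow> run K c 1 {fst (snd c)} c'"
  using run_step[OF _ run_refl] by simp

lemma run_Up_left:
  assumes "i < m"
  shows "\<exists>V. run K (Up (Suc j), x @ True # replicate m False, length x + i) i V
    (Up (Suc j), x @ True # replicate m False, length x)"
  using assms
proof (induction i)
  case 0
  show ?case by (auto intro: run_refl)
next
  case (Suc i)
  let ?a = "x @ True # replicate m False"
  have nth: "?a ! (length x + Suc i) = False"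
    using Suc.prems by (simp add: nth_append)
  have "?a[length x + Suc i := False] = ?a"
    by (metis list_update_id nth)
  then have "next_config K (Up (Suc j), ?a, length x + Suc i) = Some (Up (Suc j), ?a, length x + i)"
    using nth by (simp add: scanned_addr_def)
  then show ?case
    using run_step Suc by (metis Suc_lessD)
qed

text \<open>One loop level: place a one, let the inner level enumerate what follows, return, erase
  the one and repeat one cell further right. Each of the \<open>m\<close> positions costs two steps
  plus an inner enumeration of at most \<open>f m\<close> steps. The head finishes just left of the
  last cell; for \<open>m = 1\<close> and empty \<open>x\<close> the truncated subtraction agrees
  with the head staying at the left end.\<close>

lemma run_loop:
  assumes "j < K" "mono f" "1 \<le> m"
    and inner: "\<And>x m. 1 \<le> m \<Longrightarrow> \<exists>n V. run K (Down j, x @ True # replicate m False, Suc (length x)) n V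
        (Up j, x @ True # replicate m False, length x) \<and> n \<le> f m \<and>
      {x @ True # y | y. length y = m \<and> weight y = j} \<subseteq> V"
  shows "\<exists>n V. run K (Down (Suc j), x @ replicate m False, length x) n V
      (Up (Suc j), x @ replicate m False, length x + m - 2) \<and> n \<le> m * (2 + f m) \<and>
    {x @ y | y. length y = m \<and> weight y = Suc j} \<subseteq> V"
  using \<open>1 \<le> m\<close>
proof (induction m arbitrary: x rule: nat_induct_at_least)
  \<comment> \<open>In the rightmost cell the move to the right is blocked, so \<open>Down j\<close>
    sees the one just written, erases it and ends the loop.\<close>
  case base
  have 1: "next_config K (Down (Suc j), x @ [False], length x) = Some (Down j, x @ [True], length x)"
    by (simp add: scanned_addr_def)
  have 2: "next_config K (Down j, x @ [True], length x) = Some (Up (Suc j), x @ [False], length x - 1)"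
    using \<open>j < K\<close> by (cases j) (simp_all add: scanned_addr_def)
  have "{x @ y | y. length y = 1 \<and> weight y = Suc j} \<subseteq> {x @ [False], x @ [True]}"
    by (auto simp: length_Suc_conv)
  then show ?case
    using run_step[OF 1 run_step[OF 2 run_refl]] by (intro exI conjI) auto
next
  case (Suc m)
  let ?a = "x @ True # replicate m False"
  have 1: "next_config K (Down (Suc j), x @ replicate (Suc m) False, length x) =
      Some (Down j, ?a, Suc (length x))"
    using Suc.hyps by (simp add: scanned_addr_def)
  obtain n V where 2: "run K (Down j, ?a, Suc (length x)) n V (Up j, ?a, length x)"
    "n \<le> f m" "{x @ True # y | y. length y = m \<and> weight y = j} \<subseteq> V"
    using inner[OF Suc.hyps] by blast
  have 3: "next_config K (Up j, ?a, length x) =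
      Some (Down (Suc j), (x @ [False]) @ replicate m False, length (x @ [False]))"
    using \<open>j < K\<close> Suc.hyps by (simp add: scanned_addr_def)
  obtain n' V' where 4: "run K (Down (Suc j), (x @ [False]) @ replicate m False, length (x @ [False])) n' V'
      (Up (Suc j), (x @ [False]) @ replicate m False, length (x @ [False]) + m - 2)"
    "n' \<le> m * (2 + f m)" "{(x @ [False]) @ y | y. length y = m \<and> weight y = Suc j} \<subseteq> V'"
    using Suc.IH by blast
  have 5: "run K (Down (Suc j), x @ replicate (Suc m) False, length x) (Suc (n + Suc n'))
      (insert (x @ replicate (Suc m) False) (V \<union> insert ?a V'))
      (Up (Suc j), x @ replicate (Suc m) False, length x + Suc m - 2)"
    using run_step[OF 1 run_trans[OF 2(1) run_step[OF 3 4(1)]]] by simp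
  have "f m \<le> f (Suc m)"
    using \<open>mono f\<close> by (simp add: monoD)
  then have "m * (2 + f m) \<le> m * (2 + f (Suc m))"
    by simp
  then have 6: "Suc (n + Suc n') \<le> Suc m * (2 + f (Suc m))"
    using 2(2) 4(2) \<open>f m \<le> f (Suc m)\<close> unfolding mult_Suc by linarith
  \<comment> \<open>The first bit of \<open>y\<close> decides: a 1 is covered by the inner
    enumeration, a 0 by the loop continuing one cell further right.\<close>
  have "x @ y \<in> V \<union> V'" if y: "length y = Suc m" "weight y = Suc j" for y
  proof -
    obtain b z where z: "y = b # z"
      using y(1) by (cases y) auto
    show ?thesis
    proof (cases b)
      case True
      then show ?thesis using 2(3) y z by (auto simp: weight_def)
    next
      case False
      then have "x @ y = (x @ [False]) @ z" "length z = m" "weight z = Suc j"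
        using y z by (auto simp: weight_def)
      then show ?thesis using 4(3) by blast
    qed
  qed
  then show ?case
    using 5 6 by (intro exI conjI) auto
qed

text \<open>Level \<open>Suc j\<close> is \<open>run_loop\<close> around level \<open>j\<close>,
  followed by a walk of \<open>m - 1\<close> cells back to the one on the left. At level 0 every one
  has been placed, and the single step visits the finished address.\<close>

lemma run_Down:
  assumes "j \<le> K" "1 \<le> m"
  shows "\<exists>n V. run K (Down j, x @ True # replicate m False, Suc (length x)) n V
      (Up j, x @ True # replicate m False, length x) \<and> n \<le> (3 * j + 1) * m ^ j \<and>
    {x @ True # y | y. length y = m \<and> weight y = j} \<subseteq> V"
  using assms
proof (induction j arbitrary: x m)
  case 0
  let ?a = "x @ True # replicate m False"
  have nth: "?a ! Suc (length x) = False"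
    using 0 by (simp add: nth_append)
  have "?a[Suc (length x) := False] = ?a"
    by (metis list_update_id nth)
  then have "next_config K (Down 0, ?a, Suc (length x)) = Some (Up 0, ?a, length x)"
    using nth by (simp add: scanned_addr_def)
  from run_single[OF this]
  have "run K (Down 0, ?a, Suc (length x)) 1 {?a} (Up 0, ?a, length x)"
    by simp
  moreover have "y = replicate (length y) False" if "weight y = 0" for y
    using that by (induction y) (auto simp: weight_def split: if_splits)
  then have "{x @ True # y | y. length y = m \<and> weight y = 0} \<subseteq> {?a}"
    by auto
  ultimately show ?case
    by (intro exI conjI) auto
next
  case (Suc j)
  let ?a = "x @ True # replicate m False"
  have "mono (\<lambda>m::nat. (3 * j + 1) * m ^ j)"
    by (intro monoI mult_le_mono2 power_mono) auto
  from run_loop[OF _ this \<open>1 \<le> m\<close> Suc.IH, of "x @ [True]"] Suc.prems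
  obtain n V where 1: "run K (Down (Suc j), ?a, Suc (length x)) n V (Up (Suc j), ?a, length x + m - 1)"
    "n \<le> m * (2 + (3 * j + 1) * m ^ j)" "{x @ True # y | y. length y = m \<and> weight y = Suc j} \<subseteq> V"
    by auto
  obtain V' where "run K (Up (Suc j), ?a, length x + (m - 1)) (m - 1) V' (Up (Suc j), ?a, length x)"
    using run_Up_left[of "m - 1" m K j x] Suc.prems by auto
  moreover have "length x + m - 1 = length x + (m - 1)"
    using Suc.prems by simp
  ultimately have 2: "run K (Down (Suc j), ?a, Suc (length x)) (n + (m - 1)) (V \<union> V') (Up (Suc j), ?a, length x)"
    using run_trans[OF 1(1)] by metis
  \<comment> \<open>Besides the inner enumerations the level costs at most \<open>3 * m\<close>
    steps, \<open>2 * m\<close> for the loop and fewer than \<open>m\<close> for the walk. Since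
    \<open>m \<le> m ^ Suc j\<close>, the coefficient grows by 3.\<close>
  have "m * 1 \<le> m * m ^ j"
    using Suc.prems by (intro mult_le_mono2) simp
  moreover have "m * (2 + (3 * j + 1) * m ^ j) = 2 * m + (3 * j + 1) * (m * m ^ j)"
    by (simp add: algebra_simps)
  moreover have "(3 * Suc j + 1) * m ^ Suc j = 3 * (m * m ^ j) + (3 * j + 1) * (m * m ^ j)"
    by (simp add: algebra_simps)
  ultimately have "n + (m - 1) \<le> (3 * Suc j + 1) * m ^ Suc j"
    using 1(2) by linarith
  then show ?case
    using 2 1(3) by blast
qed

lemma complete_run:
  "\<exists>n V d. run K (Down (Suc K), replicate l False, 0) n V d \<and> next_config K d = None \<and>
    n \<le> (3 * K + 1) * l ^ K + (K + 2) \<and>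
    (2 \<le> l \<longrightarrow> {True # y | y. length y = l - 1 \<and> weight y = K} \<subseteq> V)"
proof -
  consider "l = 0" | "l = 1" | m where "l = Suc m" "1 \<le> m"
    by (cases l) force+
  then show ?thesis
  proof cases
    \<comment> \<open>On the empty tape every read gives 0, so the \<open>Down\<close> states count
      down to \<open>Up 0\<close>, which halts. This takes \<open>K + 2\<close> steps and accounts
      for the additive term of the bound.\<close>
    case 1
    have "\<exists>V. run K (Down j, [], 0) (Suc j) V (Up 0, [], 0)" for j
    proof (induction j)
      case 0
      have "next_config K (Down 0, [], 0) = Some (Up 0, [], 0)"
        by (simp add: scanned_addr_def)
      from run_single[OF this] show ?case by auto
    next
      case (Suc j)
      have "next_config K (Down (Suc j), [], 0) = Some (Down j, [], 0)"
        by (simp add: scanned_addr_def)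
      then show ?case using Suc run_step by blast
    qed
    then obtain V where "run K (Down (Suc K), [], 0) (Suc (Suc K)) V (Up 0, [], 0)"
      by blast
    then show ?thesis
      using 1 by (intro exI[of _ "Suc (Suc K)"] exI[of _ V] exI conjI) (auto simp: scanned_addr_def)
  next
    \<comment> \<open>The leading one fills the only cell; the blocked head leaves
      \<open>Down K\<close> reading it, and the machine halts.\<close>
    case 2
    have "next_config K (Down (Suc K), [False], 0) = Some (Down K, [True], 0)"
      by (simp add: scanned_addr_def)
    from run_single[OF this] show ?thesis
      using 2 by (intro exI conjI) (auto simp: scanned_addr_def gr0_conv_Suc neq0_conv elim: prog.elims)
  next
    case (3 m)
    let ?a = "True # replicate m False"
    have "next_config K (Down (Suc K), replicate l False, 0) = Some (Down K, ?a, 1)"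
      using 3 by (simp add: scanned_addr_def)
    moreover obtain n V where nV: "run K (Down K, ?a, 1) n V (Up K, ?a, 0)" "n \<le> (3 * K + 1) * m ^ K"
      "{True # y | y. length y = m \<and> weight y = K} \<subseteq> V"
      using run_Down[of K K m "[]"] 3(2) by auto
    ultimately have "run K (Down (Suc K), replicate l False, 0) (Suc n) (insert (replicate l False) V) (Up K, ?a, 0)"
      using run_step by fastforce
    moreover have "next_config K (Up K, ?a, 0) = None"
      by (simp add: scanned_addr_def)
    moreover have "(3 * K + 1) * m ^ K \<le> (3 * K + 1) * l ^ K"
      using 3(1) by (intro mult_le_mono2 power_mono) auto
    then have "Suc n \<le> (3 * K + 1) * l ^ K + (K + 2)"
      using nV(2) by linarith
    moreover have "{True # y | y. length y = l - 1 \<and> weight y = K} \<subseteq> insert (replicate l False) V"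
      using nV(3) 3(1) by auto
    ultimately show ?thesis
      by blast
  qed
qed

section \<open>Addresses as numbers, and the count of bit lists of given weight\<close>

lemma addr_value_snoc: "addr_value (a @ [b]) = of_bool b + 2 * addr_value a"
  by (simp add: addr_value_def)

lemma addr_value_less: "addr_value a < 2 ^ length a"
  by (induction a rule: rev_induct) (auto simp: addr_value_snoc, simp add: addr_value_def)

lemma addr_value_inj:
  assumes "length a = length b" "addr_value a = addr_value b"
  shows "a = b"
  using assms
proof (induction a arbitrary: b rule: rev_induct)
  case (snoc x a)
  then obtain y c where b: "b = c @ [y]" "length c = length a"
    by (cases b rule: rev_cases) auto
  have *: "of_bool x + 2 * addr_value a = of_bool y + 2 * addr_value c"
    using snoc.prems(2) by (simp add: b addr_value_snoc)
  have "odd (of_bool z + 2 * n) = z" for z and n :: nat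
    by simp
  then have "x = y"
    using * by metis
  then show ?case
    using * snoc.IH[of c] b by simp
qed simp

lemma card_weight: "card {y. length y = m \<and> weight y = j} = m choose j"
proof (induction m arbitrary: j)
  case 0
  have "{y. length y = 0 \<and> weight y = j} = (if j = 0 then {[]} else {})"
    by (auto simp: weight_def)
  then show ?case by simp
next
  case (Suc m)
  let ?S = "\<lambda>m j. {y. length y = m \<and> weight y = j}"
  have fin: "finite (?S m j)" for j
    using finite_lists_length_eq[of "UNIV :: bool set" m] by (rule rev_finite_subset) auto
  show ?case
  proof (cases j)
    case 0
    have "?S (Suc m) 0 = (#) False ` ?S m 0"
      by (auto simp: weight_def length_Suc_conv split: if_splits)
    then show ?thesis
      using Suc 0 by (simp add: card_image)
  next
    case (Suc i)
    have "?S (Suc m) (Suc i) = (#) True ` ?S m i \<union> (#) False ` ?S m (Suc i)"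
      by (auto simp: weight_def length_Suc_conv split: if_splits)
    moreover have "card ((#) True ` ?S m i \<union> (#) False ` ?S m (Suc i)) =
        card ((#) True ` ?S m i) + card ((#) False ` ?S m (Suc i))"
      using fin by (intro card_Un_disjoint) auto
    ultimately show ?thesis
      using Suc.IH Suc by (simp add: card_image)
  qed
qed

section \<open>The separating language\<close>

lemma init_config_scan_machine:
  "init_config (scan_machine K) w = config_of (Down (Suc K), replicate (addr_length (length w)) False, 0)"
  by (simp add: init_config_def scan_machine_def)

lemma num_blocks_scan_machine:
  assumes "computation (scan_machine K) w cs"
  shows "num_blocks (scan_machine K) cs \<le> 1"
proof -
  let ?M = "scan_machine K"
  have target: "state d \<in> universal ?M" if "step ?M w c d" for c d
    using step_state_states[OF wf_scan_machine that] by (simp add: states_def scan_machine_def)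
  have univ: "\<forall>c \<in> set cs. state c \<in> universal ?M"
    if "successively (step ?M w) cs" "cs \<noteq> []" "state (hd cs) \<in> universal ?M" for cs
    using that
  proof (induction cs rule: induct_list012)
    case (3 x y zs)
    from 3(3) have "step ?M w x y" "successively (step ?M w) (y # zs)"
      by simp_all
    from 3(2)[OF this(2)] target[OF this(1)] 3(5) show ?case
      by simp
  qed simp_all
  have "state (init_config ?M w) \<in> universal ?M"
    by (simp add: init_config_def scan_machine_def scan_states_def)
  then have "\<forall>c \<in> set cs. state c \<in> universal ?M"
    using assms univ[of cs] unfolding computation_def by metis
  then have "map (\<lambda>c. state c \<in> universal ?M) cs = replicate (length cs) True"
    by (intro replicate_eqI) auto
  then have "num_blocks ?M cs = length (remdups_adj (replicate (length cs) True))"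
    unfolding num_blocks_def by (rule arg_cong)
  then show ?thesis
    by (simp add: remdups_adj_replicate)
qed

lemma addr_length_bigo: "(\<lambda>n. real (a * addr_length n ^ K + b)) \<in> O(\<lambda>n. log 2 (real n) ^ K)"
proof (rule bigoI[of _ "real a * 2 ^ K + real b"])
  show "\<forall>\<^sub>F n in sequentially. norm (real (a * addr_length n ^ K + b)) \<le>
      (real a * 2 ^ K + real b) * norm (log 2 (real n) ^ K)"
    using eventually_ge_at_top[of 2]
  proof eventually_elim
    case (elim n)
    then have log: "log 2 (real n) \<ge> 1"
      by simp
    \<comment> \<open>Rounding up adds less than 1, which is at most the logarithm itself once it is
      at least 1.\<close>
    then have "real (addr_length n) \<le> 2 * log 2 (real n)"
      unfolding addr_length_def by linarith
    then have "real (addr_length n) ^ K \<le> 2 ^ K * log 2 (real n) ^ K"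
      unfolding power_mult_distrib[symmetric] by (intro power_mono) auto
    then have "real a * real (addr_length n) ^ K \<le> real a * (2 ^ K * log 2 (real n) ^ K)"
      by (intro mult_left_mono) auto
    moreover have "real b * 1 \<le> real b * log 2 (real n) ^ K"
      using log by (intro mult_left_mono one_le_power) auto
    ultimately show ?case
      using log by (simp add: algebra_simps)
  qed
qed

lemma scan_machine_ATIME_op: "language (scan_machine K) \<in> ATIME_op (\<lambda>n. log 2 (real n) ^ K) 1"
proof -
  \<comment> \<open>The additive term is one larger than in \<open>complete_run\<close>, to pay for
    the step into \<open>Accept\<close>.\<close>
  let ?t = "\<lambda>n. (3 * K + 1) * addr_length n ^ K + (K + 3)"
  have "num_steps cs \<le> ?t (length w)" if cs: "computation (scan_machine K) w cs" for w cs
  proof -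
    obtain n V d where run: "run K (Down (Suc K), replicate (addr_length (length w)) False, 0) n V d"
      "next_config K d = None" "n \<le> (3 * K + 1) * addr_length (length w) ^ K + (K + 2)"
      using complete_run by blast
    have "length cs \<le> n + 2"
      using run_computation_length[OF run(1,2), of w cs] cs
      by (simp add: computation_def init_config_scan_machine scan_states_def)
    then show ?thesis
      using run(3) by (simp add: num_steps_def)
  qed
  then have time: "num_steps cs \<le> ?t (length w) \<and> num_blocks (scan_machine K) cs \<le> 1"
    if "computation (scan_machine K) w cs" for w cs
    using that num_blocks_scan_machine[OF that] by simp
  show ?thesis
    unfolding ATIME_op_def
  proof (rule CollectI, rule exI[of _ "scan_machine K"], intro conjI)
    show "\<exists>t. (\<lambda>n. real (t n)) \<in> O(\<lambda>n. log 2 (real n) ^ K) \<and>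
      (\<forall>w cs. computation (scan_machine K) w cs \<longrightarrow>
        num_steps cs \<le> t (length w) \<and> num_blocks (scan_machine K) cs \<le> 1)"
    proof (rule exI[of _ ?t], rule conjI)
      show "(\<lambda>n. real (?t n)) \<in> O(\<lambda>n. log 2 (real n) ^ K)"
        by (rule addr_length_bigo)
      show "\<forall>w cs. computation (scan_machine K) w cs \<longrightarrow>
          num_steps cs \<le> ?t (length w) \<and> num_blocks (scan_machine K) cs \<le> 1"
        by (intro allI impI time)
    qed
  qed (simp_all add: wf_scan_machine, simp add: scan_machine_def scan_states_def)
qed

section \<open>Words inside and outside the separating language\<close>

lemma replicate_True_notin_scan_language: "replicate n True \<notin> language (scan_machine K)"
proof -
  let ?c = "(Down (Suc K), replicate (addr_length n) False, 0)"
  obtain m V d where run: "run K ?c m V d" "next_config K d = None"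
    using complete_run by blast
  have "\<not> accepting_config (scan_machine K) (replicate n True) (config_of ?c)"
    by (rule run_rejects[OF run]) (auto simp: scan_states_def scanned_input_def)
  then show ?thesis
    by (simp add: language_def init_config_scan_machine)
qed

text \<open>Length \<open>2 ^ l\<close> makes the address tape exactly \<open>l\<close> bits long,
  and each of its values is then a genuine input cell.\<close>

lemma scan_language_memI:
  assumes "length w = 2 ^ l" "l = Suc m" "1 \<le> m" "length y = m" "weight y = K"
    and "\<not> w ! addr_value (True # y)"
  shows "w \<in> language (scan_machine K)"
proof -
  have l: "addr_length (length w) = l"
    using assms(1) by (simp add: addr_length_def log_nat_power)
  let ?c = "(Down (Suc K), replicate l False, 0)"
  obtain n V d where run: "run K ?c n V d" "True # y \<in> V"
    using complete_run[of K l] assms(2-5) by auto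
  have "addr_value (True # y) < length w"
    using addr_value_less[of "True # y"] assms by simp
  then have "scanned_input w (True # y) = Bit False"
    using assms(6) by (simp add: scanned_input_def)
  then have "accepting_config (scan_machine K) w (config_of ?c)"
    by (intro run_accepts[OF run(1) _ run(2)]) (simp_all add: scan_states_def)
  then show ?thesis
    by (simp add: language_def init_config_scan_machine l)
qed

text \<open>If \<open>P\<close> missed the cell of some enumerated address, a single zero there
  would give a word that agrees with the all-ones word on \<open>P\<close> but is accepted. Hence
  \<open>P\<close> contains all these cells, which are distinct.\<close>

lemma scan_language_certificate_size:
  assumes "finite P" "1 \<le> m"
    and P: "\<And>w. \<lbrakk>length w = 2 ^ Suc m; \<forall>i \<in> P. i < 2 ^ Suc m \<longrightarrow> w ! i\<rbrakk> \<Longrightarrow> w \<notin> language (scan_machine K)"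
  shows "m choose K \<le> card P"
proof -
  let ?S = "{y. length y = m \<and> weight y = K}"
  have "addr_value (True # y) \<in> P" if y: "y \<in> ?S" for y
  proof (rule ccontr)
    assume notin: "addr_value (True # y) \<notin> P"
    let ?w = "(replicate (2 ^ Suc m) True)[addr_value (True # y) := False]"
    have "addr_value (True # y) < 2 ^ Suc m"
      using addr_value_less[of "True # y"] y by simp
    then have "?w \<in> language (scan_machine K)"
      using y assms(2) by (intro scan_language_memI[of _ "Suc m" m y]) simp_all
    moreover have "?w ! i" if "i \<in> P" "i < 2 ^ Suc m" for i
    proof -
      have "i \<noteq> addr_value (True # y)"
        using notin that(1) by blast
      then show ?thesis
        using that(2) by (simp del: power_Suc)
    qed
    ultimately show False
      using P[of ?w] by (simp del: power_Suc)
  qed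
  then have "(\<lambda>y. addr_value (True # y)) ` ?S \<subseteq> P"
    by blast
  moreover have "inj_on (\<lambda>y. addr_value (True # y)) ?S"
    using addr_value_inj[of "True # _" "True # _"] by (intro inj_onI) simp
  ultimately have "card ?S \<le> card P"
    using assms(1) by (metis card_image card_mono)
  then show ?thesis
    by (simp add: card_weight)
qed

lemma scan_language_notin_ATIME_op:
  "language (scan_machine (Suc k)) \<notin> ATIME_op (\<lambda>n. log 2 (real n) ^ k) 1"
proof
  let ?K = "Suc k"
  let ?L = "language (scan_machine ?K)"
  assume "?L \<in> ATIME_op (\<lambda>n. log 2 (real n) ^ k) 1"
  then obtain t :: "nat \<Rightarrow> nat" where t: "(\<lambda>n. real (t n)) \<in> O(\<lambda>n. log 2 (real n) ^ k)"
    and cert: "\<And>w. w \<notin> ?L \<Longrightarrow> \<exists>P. finite P \<and> card P \<le> Suc (t (length w)) \<and>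
      (\<forall>w'. length w' = length w \<and> (\<forall>i \<in> P. i < length w \<longrightarrow> w' ! i = w ! i) \<longrightarrow> w' \<notin> ?L)"
    by (rule ATIME_op_rejection_certificate) blast
  obtain c where c: "c > 0" "\<forall>\<^sub>F n in sequentially. norm (real (t n)) \<le> c * norm (log 2 (real n) ^ k)"
    using landau_o.bigE[OF t] by blast
  then obtain N where N: "\<And>n. n \<ge> N \<Longrightarrow> real (t n) \<le> c * \<bar>log 2 (real n)\<bar> ^ k"
    by (auto simp: eventually_sequentially power_abs)
  \<comment> \<open>\<open>C\<close> absorbs the loss in passing from \<open>Suc m\<close> to
    \<open>m / ?K\<close>: \<open>Suc m \<le> 2 * m = 2 * ?K * (m / ?K)\<close>, and
    \<open>(m / ?K) ^ ?K\<close> is a lower bound for the binomial coefficient.\<close>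
  define C where "C = (2 * real ?K) ^ ?K"
  \<comment> \<open>The summands make the time bound valid at \<open>?n\<close>, make the binomial
    estimate applicable, and push \<open>Suc m\<close> above \<open>(c + 1) * C\<close>, the bound
    that a certificate of the assumed size would force.\<close>
  define m where "m = N + ?K + nat \<lceil>(c + 1) * C\<rceil>"
  let ?n = "2 ^ Suc m :: nat"
  obtain P where P: "finite P" "card P \<le> Suc (t ?n)"
    "\<And>w. \<lbrakk>length w = ?n; \<forall>i \<in> P. i < ?n \<longrightarrow> w ! i\<rbrakk> \<Longrightarrow> w \<notin> ?L"
    using cert[OF replicate_True_notin_scan_language[of ?n]] by (auto simp del: power_Suc)
  have "N \<le> Suc m"
    by (simp add: m_def)
  then have "N \<le> ?n"
    using less_exp[of "Suc m"] by linarith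
  then have "real (t ?n) \<le> c * real (Suc m) ^ k"
    using N[of ?n] by (simp add: log_nat_power del: power_Suc)
  moreover have "m choose ?K \<le> card P"
    by (rule scan_language_certificate_size[OF P(1) _ P(3)]) (simp_all add: m_def)
  ultimately have upper: "real (m choose ?K) \<le> c * real (Suc m) ^ k + 1"
    using P(2) by linarith
  have "C > 0"
    unfolding C_def by (rule zero_less_power) simp
  have "?K \<le> m"
    by (simp add: m_def)
  have "2 * real ?K * (real m / real ?K) = 2 * real m"
    by (simp del: of_nat_Suc)
  with \<open>?K \<le> m\<close> have "real (Suc m) \<le> 2 * real ?K * (real m / real ?K)"
    by linarith
  then have "real (Suc m) ^ ?K \<le> (2 * real ?K * (real m / real ?K)) ^ ?K"
    by (rule power_mono) simp
  also have "\<dots> = C * (real m / real ?K) ^ ?K"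
    unfolding C_def by (rule power_mult_distrib)
  also have "\<dots> \<le> C * real (m choose ?K)"
    using binomial_ge_n_over_k_pow_k[OF \<open>?K \<le> m\<close>, where 'a = real] \<open>C > 0\<close>
    by (intro mult_left_mono) linarith+
  also have "\<dots> \<le> C * (c * real (Suc m) ^ k + 1)"
    using upper \<open>C > 0\<close> by (intro mult_left_mono) linarith+
  also have "\<dots> \<le> C * ((c + 1) * real (Suc m) ^ k)"
  proof (rule mult_left_mono)
    have "1 \<le> real (Suc m) ^ k"
      by (rule one_le_power) simp
    then show "c * real (Suc m) ^ k + 1 \<le> (c + 1) * real (Suc m) ^ k"
      unfolding distrib_right by linarith
  qed (use \<open>C > 0\<close> in linarith)
  finally have "real (Suc m) * real (Suc m) ^ k \<le> ((c + 1) * C) * real (Suc m) ^ k"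
    by (simp only: power_Suc mult_ac)
  then have "real (Suc m) \<le> (c + 1) * C"
    by (rule mult_right_le_imp_le) simp
  moreover have "(c + 1) * C < real (Suc m)"
    unfolding m_def by linarith
  ultimately show False
    by linarith
qed

section \<open>Inclusion of the classes and its strictness\<close>

lemma ATIME_op_mono:
  assumes "f \<in> O(g)"
  shows "ATIME_op f m \<subseteq> ATIME_op g m"
  unfolding ATIME_op_def using landau_o.big_trans[OF _ assms] by blast

lemma log_power_bigo_Suc: "(\<lambda>n. log 2 (real n) ^ k) \<in> O(\<lambda>n. log 2 (real n) ^ (k + 1))"
proof (rule bigoI[of _ 1])
  show "\<forall>\<^sub>F n in sequentially. norm (log 2 (real n) ^ k) \<le> 1 * norm (log 2 (real n) ^ (k + 1))"
    using eventually_ge_at_top[of 2]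
  proof eventually_elim
    case (elim n)
    then have "1 \<le> \<bar>log 2 (real n)\<bar>"
      by simp
    then show ?case
      using power_increasing[of k "k + 1" "\<bar>log 2 (real n)\<bar>"] by (simp only: power_abs real_norm_def mult_1 le_add1)
  qed
qed

theorem theorem3:
  fixes k :: nat
  assumes "k > 1"
  shows "ATIME_op (\<lambda>n. log 2 (real n) ^ k) 1 \<subset> ATIME_op (\<lambda>n. log 2 (real n) ^ (k + 1)) 1"
  using ATIME_op_mono[OF log_power_bigo_Suc, of k 1] scan_machine_ATIME_op[of "k + 1"]
    scan_language_notin_ATIME_op[of k]
  by auto

end
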